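(* Let $n\ge k\ge 2$, let $G$ be a $k$-uniform hypergraph with vertex set $[n]$, and let $\mathbf{x}$ be a unit nonnegative eigenvector of $\mathcal{A}(G)$ corresponding to $\rho(G)$. Let $v\in V(G)$ and let $\mathbf{y}$ be the restriction of $\mathbf{x}$ to $[n]\setminus\{v\}$. Then $$(1-kx_v^k)\,\rho(G)\le \rho(G-v)\le \rho(G).$$ Moreover, if $x_v^k\ne 1$, then $$\rho(G-v)\ge \frac{1-kx_v^k}{1-x_v^k}\,\rho(G),$$ and if $G$ is connected, then equality holds in this last inequality if and only if $\mathbf{y}$ is an eigenvector of $\mathcal{A}(G-v)$ associated with $\rho(G-v)$.
   Context: $[n]=\{1,\dots,n\}$. A $k$-uniform hypergraph $G$ has vertex set $V(G)$ and edge set $E(G)$ consisting of $k$-element subsets of $V(G)$. Its adjacency tensor $\mathcal{A}(G)=(a_{i_1\dots i_k})$ has order $k$ and dimension $|V(G)|$, with $a_{i_1\dots i_k}=\frac{1}{(k-1)!}$ if $\{i_1,\dots,i_k\}\in E(G)$ and $0$ otherwise. A nonzero vector $\mathbf{x}$ indexed by $V(G)$ is an eigenvector of $\mathcal{A}(G)$ for the eigenvalue $\lambda$ if $\lambda x_u^{k-1}=\sum_{e\in E(G),\,u\in e}\prod_{w\in e\setminus\{u\}}x_w$ for all $u\in V(G)$. The spectral radius $\rho(G)$ is the largest modulus of the (complex) eigenvalues of $\mathcal{A}(G)$; it equals the largest H-eigenvalue (real eigenvalue with a real eigenvector). A real vector is unit if $\sum_i|x_i|^k=1$. $G-v$ is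 the hypergraph with vertex set $V(G)\setminus\{v\}$ whose edges are the edges of $G$ not containing $v$. *)

theory Defs
  imports Complex_Main "HOL-Library.FuncSet" "HOL-Combinatorics.Multiset_Permutations"
begin

record 'a hypergraph =
  hverts :: "'a set"
  hedges :: "'a set set"

definition uniform_hypergraph :: "nat \<Rightarrow> 'a hypergraph \<Rightarrow> bool" where
  "uniform_hypergraph k G \<longleftrightarrow>
     finite (hverts G) \<and> (\<forall>e\<in>hedges G. e \<subseteq> hverts G \<and> card e = k)"

definition delete_vertex :: "'a hypergraph \<Rightarrow> 'a \<Rightarrow> 'a hypergraph" where
  "delete_vertex G v =
     \<lparr>hverts = hverts G - {v}, hedges = {e \<in> hedges G. v \<notin> e}\<rparr>"

definition hadjacent :: "'a hypergraph \<Rightarrow> ('a \<times> 'a) set" where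
  "hadjacent G = {(u, w). \<exists>e\<in>hedges G. u \<in> e \<and> w \<in> e}"

definition connected_hypergraph :: "'a hypergraph \<Rightarrow> bool" where
  "connected_hypergraph G \<longleftrightarrow>
     (\<forall>u\<in>hverts G. \<forall>w\<in>hverts G. (u, w) \<in> (hadjacent G)\<^sup>*)"

text \<open>A tensor of order \<open>k\<close> over a finite index set \<open>V\<close> is a function on lists of indices, of which
  only the values on lists of length \<open>k\<close> over \<open>V\<close> matter. Likewise, a vector indexed by \<open>V\<close> is a
  function of which only the values on \<open>V\<close> matter.\<close>

definition tensor_apply ::
    "nat \<Rightarrow> 'a set \<Rightarrow> ('a list \<Rightarrow> 'b) \<Rightarrow> ('a \<Rightarrow> 'b) \<Rightarrow> 'a \<Rightarrow> 'b::comm_semiring_1" where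
  "tensor_apply k V A x i =
     (\<Sum>js | set js \<subseteq> V \<and> length js = k - 1. A (i # js) * (\<Prod>j\<leftarrow>js. x j))"

definition tensor_eigenvector ::
    "nat \<Rightarrow> 'a set \<Rightarrow> ('a list \<Rightarrow> 'b) \<Rightarrow> 'b \<Rightarrow> ('a \<Rightarrow> 'b::comm_semiring_1) \<Rightarrow> bool" where
  "tensor_eigenvector k V A l x \<longleftrightarrow>
     (\<exists>i\<in>V. x i \<noteq> 0) \<and> (\<forall>i\<in>V. l * x i ^ (k - 1) = tensor_apply k V A x i)"

definition adjacency_tensor :: "nat \<Rightarrow> 'a hypergraph \<Rightarrow> 'a list \<Rightarrow> 'b::field_char_0" where
  "adjacency_tensor k G is = (if set is \<in> hedges G then 1 / fact (k - 1) else 0)"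

definition adjacency_eigenvector ::
    "nat \<Rightarrow> 'a hypergraph \<Rightarrow> 'b \<Rightarrow> ('a \<Rightarrow> 'b::field_char_0) \<Rightarrow> bool" where
  "adjacency_eigenvector k G l x \<longleftrightarrow>
     tensor_eigenvector k (hverts G) (adjacency_tensor k G) l x"

text \<open>The supremum is a maximum for \<open>k \<ge> 2\<close> and a nonempty finite vertex set: the set of
  eigenvalues is then nonempty, and it is compact because the eigenvectors can be normalised.\<close>

definition hspectral_radius :: "nat \<Rightarrow> 'a hypergraph \<Rightarrow> real" where
  "hspectral_radius k G =
     Sup {cmod l | l. \<exists>x :: 'a \<Rightarrow> complex. adjacency_eigenvector k G l x}"

lemma tensor_apply_adjacency:
  fixes x :: "'a \<Rightarrow> 'b::field_char_0"
  assumes G: "uniform_hypergraph k G" and k: "k \<ge> 1"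
  shows "tensor_apply k (hverts G) (adjacency_tensor k G) x u =
           (\<Sum>e | e \<in> hedges G \<and> u \<in> e. \<Prod>w\<in>e - {u}. x w)"
proof -
  let ?E = "{e \<in> hedges G. u \<in> e}"
  let ?L = "{js. set js \<subseteq> hverts G \<and> length js = k - 1}"
  let ?t = "\<lambda>js. adjacency_tensor k G (u # js) * (\<Prod>j\<leftarrow>js. x j)"
  let ?P = "\<lambda>e. permutations_of_set (e - {u})"
  have finV: "finite (hverts G)" and sub: "\<And>e. e \<in> hedges G \<Longrightarrow> e \<subseteq> hverts G"
    and ck: "\<And>e. e \<in> hedges G \<Longrightarrow> card e = k"
    using G by (auto simp: uniform_hypergraph_def)
  have fine: "finite e" if "e \<in> hedges G" for e
    using that sub finV finite_subset by blast
  have finE: "finite ?E"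
    by (rule finite_subset[of _ "Pow (hverts G)"]) (use sub finV in auto)
  have finL: "finite ?L" by (rule finite_lists_length_eq[OF finV])
  have cE: "card (e - {u}) = k - 1" if "e \<in> ?E" for e
    using that ck fine by simp
  have len: "length js = k - 1 \<and> set js = e - {u}" if "e \<in> ?E" "js \<in> ?P e" for e js
    using that cE[OF that(1)]
    by (metis permutations_of_setD distinct_card)
  have subL: "(\<Union>e\<in>?E. ?P e) \<subseteq> ?L" using len sub by fastforce
  have zero: "?t js = 0" if "js \<in> ?L - (\<Union>e\<in>?E. ?P e)" for js
  proof -
    have "set (u # js) \<notin> hedges G"
    proof
      assume a: "set (u # js) \<in> hedges G"
      have l: "length (u # js) = k" using that k by auto
      have d: "distinct (u # js)" using ck[OF a] l by (intro card_distinct) simp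
      have "set (u # js) - {u} = set js" using d by auto
      then have "js \<in> ?P (set (u # js))" using d by (simp add: permutations_of_set_def)
      moreover have "set (u # js) \<in> ?E" using a by simp
      ultimately have "js \<in> (\<Union>e\<in>?E. ?P e)" by (rule UN_I[rotated])
      then show False using that by (simp only: Diff_iff simp_thms)
    qed
    then show ?thesis by (simp add: adjacency_tensor_def)
  qed
  have disj: "?P e \<inter> ?P e' = {}" if "e \<in> ?E" "e' \<in> ?E" "e \<noteq> e'" for e e'
  proof -
    have "e - {u} \<noteq> e' - {u}" using that by blast
    then show ?thesis by (metis permutations_of_setD(1) disjoint_iff)
  qed
  have inner: "(\<Sum>js\<in>?P e. ?t js) = (\<Prod>w\<in>e - {u}. x w)" if e: "e \<in> ?E" for e
  proof -
    have "?t js = (\<Prod>w\<in>e - {u}. x w) / fact (k - 1)" if js: "js \<in> ?P e" for js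
    proof -
      have s: "set js = e - {u}" and d: "distinct js" using js permutations_of_setD by auto
      have "insert u (set js) = e" using s e by auto
      moreover have "(\<Prod>j\<leftarrow>js. x j) = (\<Prod>w\<in>e - {u}. x w)"
        using s d by (metis prod.distinct_set_conv_list)
      ultimately show ?thesis using e by (simp add: adjacency_tensor_def)
    qed
    then have "(\<Sum>js\<in>?P e. ?t js) = of_nat (card (?P e)) * ((\<Prod>w\<in>e - {u}. x w) / fact (k - 1))"
      by simp
    also have "card (?P e) = fact (k - 1)"
      using cE[OF e] fine e by (simp add: card_permutations_of_set)
    finally show ?thesis by simp
  qed
  have "tensor_apply k (hverts G) (adjacency_tensor k G) x u = (\<Sum>js\<in>(\<Union>e\<in>?E. ?P e). ?t js)"
    unfolding tensor_apply_def
    by (rule sum.mono_neutral_right[OF finL subL]) (use zero in blast)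
  also have "\<dots> = (\<Sum>e\<in>?E. \<Sum>js\<in>?P e. ?t js)"
    by (rule sum.UNION_disjoint[OF finE]) (use disj in auto)
  also have "\<dots> = (\<Sum>e\<in>?E. \<Prod>w\<in>e - {u}. x w)"
    by (rule sum.cong[OF refl]) (rule inner)
  finally show ?thesis .
qed

lemma adjacency_eigenvector_iff:
  fixes x :: "'a \<Rightarrow> 'b::field_char_0"
  assumes "uniform_hypergraph k G" "k \<ge> 1"
  shows "adjacency_eigenvector k G l x \<longleftrightarrow>
    (\<exists>u\<in>hverts G. x u \<noteq> 0) \<and>
    (\<forall>u\<in>hverts G. l * x u ^ (k - 1) = (\<Sum>e | e \<in> hedges G \<and> u \<in> e. \<Prod>w\<in>e - {u}. x w))"
  by (simp add: adjacency_eigenvector_def tensor_eigenvector_def tensor_apply_adjacency[OF assms])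

end

theory Submission
  imports Defs "HOL-Analysis.Analysis"
begin

text \<open>
  The proof is variational. For a \<open>k\<close>-uniform hypergraph let \<open>F z\<close> be the sum over the edges \<open>e\<close> of
  the product of the entries \<open>z w\<close>, \<open>w \<in> e\<close>. Everything rests on the Perron--Frobenius type fact that
  the spectral radius \<open>\<rho>\<close> is the maximum of \<open>k * F z\<close> over the nonnegative vectors with
  \<open>\<Sum> z i ^ k = 1\<close>, and that every maximiser is an eigenvector for \<open>\<rho>\<close>. Let \<open>M\<close> be the maximum; it
  exists by compactness (lemma \<open>edge_form_attains_max\<close>). Multiplying the eigenvalue equation at \<open>u\<close>
  by \<open>x u\<close> and summing over \<open>u\<close> gives \<open>l * \<Sum> x u ^ k = k * F x\<close> by Euler's identity; with absolute
  values inserted, every complex eigenvalue has modulus at most \<open>M\<close>. Conversely a maximiser satisfies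
  the first-order conditions, which are precisely the eigenvalue equations for \<open>M\<close> (lemma
  \<open>edge_form_maximiser_eigenvector\<close>), so \<open>M\<close> itself is an eigenvalue.

  Given this, let \<open>x\<close> be the unit eigenvector of \<open>G\<close>. The edges at \<open>v\<close> contribute
  \<open>x v * (\<rho> * x v ^ (k - 1)) = \<rho> * x v ^ k\<close> to \<open>F x\<close>, so deleting \<open>v\<close> leaves
  \<open>k * F y = (1 - k * x v ^ k) * \<rho>\<close>, while \<open>\<Sum> y i ^ k = 1 - x v ^ k\<close>. The maximum property for
  \<open>G - v\<close> yields
  \<open>(1 - k * x v ^ k) * \<rho> \<le> (1 - x v ^ k) * \<rho>(G - v)\<close>, which contains both lower bounds. Equality means
  that \<open>y\<close> is, up to scaling, a maximiser for \<open>G - v\<close>, that is, an eigenvector for \<open>\<rho>(G - v)\<close>;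
  conversely, if \<open>y\<close> is such an eigenvector, Euler's identity returns the equality.
  The upper bound holds because a maximiser for \<open>G - v\<close> extended by \<open>0\<close> is admissible for \<open>G\<close>.
\<close>

section \<open>The edge form of a hypergraph\<close>

definition edge_form :: "'a hypergraph \<Rightarrow> ('a \<Rightarrow> 'b::comm_semiring_1) \<Rightarrow> 'b" where
  "edge_form H z = (\<Sum>e\<in>hedges H. \<Prod>w\<in>e. z w)"

text \<open>The partial derivative of the edge form in the direction \<open>u\<close>; it is also the right-hand side of
  the eigenvalue equation at \<open>u\<close>.\<close>

definition edge_form_partial :: "'a hypergraph \<Rightarrow> ('a \<Rightarrow> 'b::comm_semiring_1) \<Rightarrow> 'a \<Rightarrow> 'b" where
  "edge_form_partial H z u = (\<Sum>e | e \<in> hedges H \<and> u \<in> e. \<Prod>w\<in>e - {u}. z w)"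

lemma uniform_hypergraphD:
  assumes "uniform_hypergraph k H"
  shows "finite (hverts H)" "finite (hedges H)"
    and "\<And>e. e \<in> hedges H \<Longrightarrow> e \<subseteq> hverts H \<and> finite e \<and> card e = k"
proof -
  show fin: "finite (hverts H)" using assms by (simp add: uniform_hypergraph_def)
  show "finite (hedges H)"
    by (rule finite_subset[of _ "Pow (hverts H)"]) (use assms fin in \<open>auto simp: uniform_hypergraph_def\<close>)
  show "e \<subseteq> hverts H \<and> finite e \<and> card e = k" if "e \<in> hedges H" for e
    using assms that fin by (auto simp: uniform_hypergraph_def intro: finite_subset)
qed

lemma adjacency_eigenvector_iff_partial:
  fixes x :: "'a \<Rightarrow> 'b::field_char_0"
  assumes "uniform_hypergraph k H" "k \<ge> 1"
  shows "adjacency_eigenvector k H l x \<longleftrightarrow>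
    (\<exists>u\<in>hverts H. x u \<noteq> 0) \<and> (\<forall>u\<in>hverts H. l * x u ^ (k - 1) = edge_form_partial H x u)"
  unfolding adjacency_eigenvector_iff[OF assms] edge_form_partial_def ..

lemma edge_form_cong:
  assumes "uniform_hypergraph k H" "\<And>i. i \<in> hverts H \<Longrightarrow> x i = z i"
  shows "edge_form H x = edge_form H z"
  unfolding edge_form_def
proof (intro sum.cong prod.cong refl)
  fix e w assume "e \<in> hedges H" "w \<in> e"
  then show "x w = z w" using assms uniform_hypergraphD(3) by blast
qed

lemma edge_form_nonneg:
  fixes z :: "'a \<Rightarrow> real"
  assumes "uniform_hypergraph k H" "\<And>i. i \<in> hverts H \<Longrightarrow> 0 \<le> z i"
  shows "0 \<le> edge_form H z"
  unfolding edge_form_def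
proof (intro sum_nonneg prod_nonneg)
  fix e w assume "e \<in> hedges H" "w \<in> e"
  then show "0 \<le> z w" using assms uniform_hypergraphD(3) by blast
qed

lemma edge_form_partial_nonneg:
  fixes z :: "'a \<Rightarrow> real"
  assumes "uniform_hypergraph k H" "\<And>i. i \<in> hverts H \<Longrightarrow> 0 \<le> z i"
  shows "0 \<le> edge_form_partial H z u"
  unfolding edge_form_partial_def
proof (intro sum_nonneg prod_nonneg)
  fix e w assume "e \<in> {e. e \<in> hedges H \<and> u \<in> e}" "w \<in> e - {u}"
  then show "0 \<le> z w" using assms uniform_hypergraphD(3) by blast
qed

lemma edge_form_scale:
  assumes "uniform_hypergraph k H"
  shows "edge_form H (\<lambda>i. c * z i) = c ^ k * edge_form H z"
  unfolding edge_form_def sum_distrib_left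
  by (intro sum.cong refl) (use uniform_hypergraphD(3)[OF assms] in \<open>simp add: prod.distrib\<close>)

text \<open>Since \<open>u\<close> occurs at most once in each edge, the edge form is affine in the coordinate \<open>z u\<close>.\<close>

lemma edge_form_split:
  assumes H: "uniform_hypergraph k H"
  shows "edge_form H z = edge_form (delete_vertex H u) z + z u * edge_form_partial H z u"
proof -
  have "edge_form H z = (\<Sum>e | e \<in> hedges H \<and> u \<notin> e. \<Prod>w\<in>e. z w)
      + (\<Sum>e | e \<in> hedges H \<and> u \<in> e. \<Prod>w\<in>e. z w)"
    unfolding edge_form_def
    by (subst sum.union_disjoint[symmetric])
      (use uniform_hypergraphD(2)[OF H] in \<open>auto intro!: sum.cong\<close>)
  also have "(\<Sum>e | e \<in> hedges H \<and> u \<in> e. \<Prod>w\<in>e. z w) = z u * edge_form_partial H z u"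
    unfolding edge_form_partial_def sum_distrib_left
    by (intro sum.cong refl) (use uniform_hypergraphD(3)[OF H] in \<open>auto intro!: prod.remove\<close>)
  finally show ?thesis by (simp add: edge_form_def delete_vertex_def)
qed

lemma edge_form_update:
  assumes H: "uniform_hypergraph k H"
  shows "edge_form H (z(u := t)) = edge_form (delete_vertex H u) z + t * edge_form_partial H z u"
proof -
  have "edge_form (delete_vertex H u) (z(u := t)) = edge_form (delete_vertex H u) z"
    by (auto simp: edge_form_def delete_vertex_def intro!: sum.cong prod.cong)
  moreover have "edge_form_partial H (z(u := t)) u = edge_form_partial H z u"
    by (auto simp: edge_form_partial_def intro!: sum.cong prod.cong)
  ultimately show ?thesis by (simp add: edge_form_split[OF H, of "z(u := t)" u])
qed

text \<open>Euler's identity for a form of degree \<open>k\<close>: in the double sum each edge is counted once for each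
  of its \<open>k\<close> vertices.\<close>

lemma edge_form_euler:
  assumes H: "uniform_hypergraph k H"
  shows "(\<Sum>u\<in>hverts H. z u * edge_form_partial H z u) = of_nat k * edge_form H z"
proof -
  note fin = uniform_hypergraphD[OF H]
  have "(\<Sum>u\<in>hverts H. z u * edge_form_partial H z u)
      = (\<Sum>u\<in>hverts H. \<Sum>e | e \<in> hedges H \<and> u \<in> e. \<Prod>w\<in>e. z w)"
    unfolding edge_form_partial_def sum_distrib_left
    by (intro sum.cong refl) (use fin in \<open>auto intro!: prod.remove[symmetric]\<close>)
  also have "\<dots> = (\<Sum>e\<in>hedges H. \<Sum>u | u \<in> hverts H \<and> u \<in> e. \<Prod>w\<in>e. z w)"
    by (rule sum.swap_restrict) (use fin in auto)
  also have "\<dots> = (\<Sum>e\<in>hedges H. of_nat k * (\<Prod>w\<in>e. z w))"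
  proof (intro sum.cong refl)
    fix e assume e: "e \<in> hedges H"
    then have "{u. u \<in> hverts H \<and> u \<in> e} = e" using fin(3) by blast
    then show "(\<Sum>u | u \<in> hverts H \<and> u \<in> e. \<Prod>w\<in>e. z w) = of_nat k * (\<Prod>w\<in>e. z w)"
      using fin(3)[OF e] by simp
  qed
  finally show ?thesis by (simp add: edge_form_def sum_distrib_left)
qed

lemma eigenvector_edge_form:
  fixes x :: "'a \<Rightarrow> 'b::field_char_0"
  assumes H: "uniform_hypergraph k H" and k: "k \<ge> 1" and x: "adjacency_eigenvector k H l x"
  shows "of_nat k * edge_form H x = l * (\<Sum>u\<in>hverts H. x u ^ k)"
proof -
  have "x u * edge_form_partial H x u = l * x u ^ k" if "u \<in> hverts H" for u
  proof -
    have "edge_form_partial H x u = l * x u ^ (k - 1)"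
      using x that by (simp add: adjacency_eigenvector_iff_partial[OF H k])
    then show ?thesis using k by (simp add: power_eq_if)
  qed
  then show ?thesis by (simp flip: edge_form_euler[OF H] add: sum_distrib_left)
qed

section \<open>Maximising the edge form over nonnegative unit vectors\<close>

text \<open>Optimality is stated in homogeneous form, so that it can later be tested against perturbations
  that leave the unit sphere.\<close>

lemma edge_form_attains_max:
  fixes H :: "'a hypergraph"
  assumes H: "uniform_hypergraph k H" and k: "k \<ge> 1" and ne: "hverts H \<noteq> {}"
  obtains z :: "'a \<Rightarrow> real" where "\<And>i. i \<in> hverts H \<Longrightarrow> 0 \<le> z i" "(\<Sum>i\<in>hverts H. z i ^ k) = 1"
    and "\<And>y :: 'a \<Rightarrow> real. (\<forall>i\<in>hverts H. 0 \<le> y i) \<Longrightarrow>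
           edge_form H y \<le> edge_form H z * (\<Sum>i\<in>hverts H. y i ^ k)"
proof -
  note fin = uniform_hypergraphD[OF H]
  \<comment> \<open>Entries outside the vertex set are pinned to 0, so that Tychonoff's theorem applies.\<close>
  define B :: "('a \<Rightarrow> real) set" where "B = (\<Pi>\<^sub>E i\<in>UNIV. if i \<in> hverts H then {0..1} else {0})"
  define S where "S = B \<inter> {z. (\<Sum>i\<in>hverts H. z i ^ k) = 1}"
  have "compactin (product_topology (\<lambda>i. euclidean) UNIV) B"
    unfolding B_def by (subst compactin_PiE) auto
  then have "compact B" by (simp add: euclidean_product_topology)
  moreover have "closed {z::'a \<Rightarrow> real. (\<Sum>i\<in>hverts H. z i ^ k) = 1}"
    by (intro closed_Collect_eq continuous_intros continuous_on_product_coordinates)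
  ultimately have "compact S" unfolding S_def by (rule compact_Int_closed)
  moreover have "S \<noteq> {}"
  proof -
    obtain a where a: "a \<in> hverts H" using ne by blast
    have "(\<Sum>i\<in>hverts H. (if i = a then 1 else 0::real) ^ k) = (\<Sum>i\<in>hverts H. if i = a then 1 else 0)"
      using k by (intro sum.cong) auto
    then have "(\<lambda>i. if i = a then 1 else 0) \<in> S"
      using a fin(1) by (auto simp: S_def B_def)
    then show ?thesis by blast
  qed
  moreover have "continuous_on S (edge_form H :: ('a \<Rightarrow> real) \<Rightarrow> real)"
    unfolding edge_form_def
    by (intro continuous_intros continuous_on_subset[OF continuous_on_product_coordinates] subset_UNIV)
  ultimately have "\<exists>z\<in>S. \<forall>y\<in>S. edge_form H y \<le> edge_form H z"
    by (rule continuous_attains_sup)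
  then obtain z where z: "z \<in> S" and max: "\<And>y. y \<in> S \<Longrightarrow> edge_form H y \<le> edge_form H z"
    by blast
  have zB: "z \<in> B" and z1: "(\<Sum>i\<in>hverts H. z i ^ k) = 1" using z by (auto simp: S_def)
  have z0: "0 \<le> z i" if "i \<in> hverts H" for i
  proof -
    have "z i \<in> (if i \<in> hverts H then {0..1} else {0})"
      using zB unfolding B_def by (rule PiE_mem) simp
    then show ?thesis using that by simp
  qed
  show ?thesis
  proof (rule that[OF z0 z1])
    fix y :: "'a \<Rightarrow> real"
    assume "\<forall>i\<in>hverts H. 0 \<le> y i"
    then have y0: "\<And>i. i \<in> hverts H \<Longrightarrow> 0 \<le> y i" by blast
    define s where "s = (\<Sum>i\<in>hverts H. y i ^ k)"
    have s0: "0 \<le> s" unfolding s_def using y0 by (simp add: sum_nonneg)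
    show "edge_form H y \<le> edge_form H z * (\<Sum>i\<in>hverts H. y i ^ k)"
    proof (cases "s = 0")
      case True
      have "y i = 0" if "i \<in> hverts H" for i
        using True that y0 k unfolding s_def
        by (subst (asm) sum_nonneg_eq_0_iff) (use fin in auto)
      then have "edge_form H y = edge_form H (\<lambda>i. 0 * y i)" by (intro edge_form_cong[OF H]) simp
      also have "\<dots> = 0" unfolding edge_form_scale[OF H] using k by simp
      finally show ?thesis using True by (simp add: s_def)
    next
      case False
      \<comment> \<open>Both sides are homogeneous of degree \<open>k\<close>, so \<open>y\<close> may be normalised.\<close>
      define c where "c = root k (1 / s)"
      have c0: "0 \<le> c" and ck: "c ^ k = 1 / s"
        using s0 k by (auto simp: c_def)
      define y' where "y' i = (if i \<in> hverts H then c * y i else 0)" for i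
      have n1: "(\<Sum>i\<in>hverts H. y' i ^ k) = 1"
        using False ck by (simp add: y'_def power_mult_distrib s_def flip: sum_divide_distrib)
      have le1: "y' i \<le> 1" if i: "i \<in> hverts H" for i
      proof -
        have "y' i ^ k \<le> (\<Sum>i\<in>hverts H. y' i ^ k)"
          using i fin(1) c0 y0 by (intro member_le_sum) (auto simp: y'_def)
        moreover have "0 \<le> y' i" using i c0 y0 by (simp add: y'_def)
        ultimately show ?thesis using n1 k by (simp add: power_le_one_iff)
      qed
      have "y' \<in> S" using n1 le1 c0 y0 by (auto simp: S_def B_def PiE_iff y'_def)
      then have "edge_form H y' \<le> edge_form H z" by (rule max)
      moreover have "edge_form H y' = edge_form H y / s"
      proof -
        have "edge_form H y' = edge_form H (\<lambda>i. c * y i)"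
          by (intro edge_form_cong[OF H]) (simp add: y'_def)
        then show ?thesis by (simp add: edge_form_scale[OF H] ck)
      qed
      ultimately show ?thesis using False s0 by (simp add: pos_divide_le_eq flip: s_def)
    qed
  qed
qed

text \<open>The first-order condition at a minimum of \<open>t \<mapsto> M * t ^ k - k * c * t\<close> on the half-line
  \<open>t \<ge> 0\<close>. At the boundary point \<open>a = 0\<close> it only gives \<open>c \<le> 0\<close>, hence the sign condition on \<open>c\<close>.\<close>

lemma half_line_min_critical:
  fixes M c a :: real
  assumes k: "2 \<le> k" and a: "0 \<le> a" and c: "0 \<le> c"
    and min: "\<And>t. 0 \<le> t \<Longrightarrow> M * a ^ k - real k * c * a \<le> M * t ^ k - real k * c * t"
  shows "M * a ^ (k - 1) = c"
proof (cases "a = 0")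
  case False
  have "((\<lambda>t. M * t ^ k - real k * c * t) has_real_derivative M * (real k * a ^ (k - 1)) - real k * c) (at a)"
    by (auto intro!: derivative_eq_intros)
  then have "M * (real k * a ^ (k - 1)) - real k * c = 0"
    by (rule DERIV_local_min[where d = a]) (use False a min in auto)
  then have "real k * (M * a ^ (k - 1) - c) = 0" by (simp add: algebra_simps)
  then show ?thesis using k by simp
next
  case True
  have "real k * c \<le> M * t ^ (k - 1)" if t: "0 < t" for t
  proof -
    have "t * (real k * c) \<le> t * (M * t ^ (k - 1))"
      using min[of t] t True k by (simp add: power_eq_if algebra_simps)
    then show ?thesis using t by simp
  qed
  then have "\<forall>\<^sub>F t in at_right 0. real k * c \<le> M * t ^ (k - 1)"
    by (auto simp: eventually_at_filter)
  moreover have "((\<lambda>t. M * t ^ (k - 1)) \<longlongrightarrow> M * 0 ^ (k - 1)) (at_right 0)"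
    by (intro tendsto_intros)
  ultimately have "real k * c \<le> M * 0 ^ (k - 1)"
    by (intro tendsto_lowerbound) auto
  then have "c \<le> 0" using k by (simp add: mult_le_0_iff power_0_left)
  then show ?thesis using c k True by simp
qed

text \<open>Varying one coordinate \<open>z u\<close> at a time keeps the vector admissible, and along this line the
  defect of the inequality is \<open>M * t ^ k - k * c * t\<close> up to a constant, with \<open>c\<close> the partial derivative.
  Its minimality at \<open>t = z u\<close> is the eigenvalue equation at \<open>u\<close>.\<close>

lemma edge_form_maximiser_eigenvector:
  fixes z :: "'a \<Rightarrow> real"
  assumes H: "uniform_hypergraph k H" and k: "2 \<le> k"
    and max: "\<And>y. (\<forall>i\<in>hverts H. 0 \<le> y i) \<Longrightarrow>
                real k * edge_form H y \<le> M * (\<Sum>i\<in>hverts H. y i ^ k)"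
    and z0: "\<And>i. i \<in> hverts H \<Longrightarrow> 0 \<le> z i" and nz: "\<exists>i\<in>hverts H. z i \<noteq> 0"
    and eq: "real k * edge_form H z = M * (\<Sum>i\<in>hverts H. z i ^ k)"
  shows "adjacency_eigenvector k H M z"
proof -
  have "M * z u ^ (k - 1) = edge_form_partial H z u" if u: "u \<in> hverts H" for u
  proof (rule half_line_min_critical[OF k z0[OF u]])
    show "0 \<le> edge_form_partial H z u" by (rule edge_form_partial_nonneg[OF H z0])
  next
    fix t :: real assume t: "0 \<le> t"
    define R where "R = (\<Sum>i\<in>hverts H - {u}. z i ^ k)"
    have fin: "finite (hverts H)" using uniform_hypergraphD[OF H] by blast
    have sum_t: "(\<Sum>i\<in>hverts H. (z(u := t)) i ^ k) = t ^ k + R"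
      unfolding R_def by (subst sum.remove[OF fin u]) auto
    have sum_z: "(\<Sum>i\<in>hverts H. z i ^ k) = z u ^ k + R"
      unfolding R_def by (rule sum.remove[OF fin u])
    have "real k * edge_form H (z(u := t)) \<le> M * (\<Sum>i\<in>hverts H. (z(u := t)) i ^ k)"
      by (rule max) (use t z0 in auto)
    then show "M * z u ^ k - real k * edge_form_partial H z u * z u
        \<le> M * t ^ k - real k * edge_form_partial H z u * t"
      using eq
      unfolding edge_form_update[OF H] sum_t sum_z edge_form_split[OF H, of z u]
      by (simp add: algebra_simps)
  qed
  then show ?thesis using nz k by (simp add: adjacency_eigenvector_iff_partial[OF H])
qed

section \<open>The variational characterisation of the spectral radius\<close>

text \<open>Taking absolute values in the eigenvalue equations turns them into inequalities, to which Euler's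
  identity still applies.\<close>

lemma cmod_eigenvalue_le_edge_form:
  fixes x :: "'a \<Rightarrow> complex"
  assumes H: "uniform_hypergraph k H" and k: "k \<ge> 1" and x: "adjacency_eigenvector k H l x"
  shows "cmod l * (\<Sum>u\<in>hverts H. cmod (x u) ^ k) \<le> real k * edge_form H (\<lambda>u. cmod (x u))"
proof -
  have "cmod l * cmod (x u) ^ k \<le> cmod (x u) * edge_form_partial H (\<lambda>u. cmod (x u)) u"
    if u: "u \<in> hverts H" for u
  proof -
    have "l * x u ^ (k - 1) = edge_form_partial H x u"
      using x u by (simp add: adjacency_eigenvector_iff_partial[OF H k])
    then have "cmod l * cmod (x u) ^ (k - 1) = cmod (edge_form_partial H x u)"
      by (metis norm_mult norm_power)
    also have "\<dots> \<le> edge_form_partial H (\<lambda>u. cmod (x u)) u"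
      unfolding edge_form_partial_def prod_norm by (rule norm_sum)
    finally have "cmod (x u) * (cmod l * cmod (x u) ^ (k - 1))
        \<le> cmod (x u) * edge_form_partial H (\<lambda>u. cmod (x u)) u"
      by (rule mult_left_mono) simp
    then show ?thesis using k by (simp add: power_eq_if mult_ac)
  qed
  then show ?thesis
    unfolding sum_distrib_left edge_form_euler[OF H, symmetric, of "\<lambda>u. cmod (x u)"]
    by (rule sum_mono)
qed

lemma adjacency_eigenvector_of_real:
  fixes z :: "'a \<Rightarrow> real"
  assumes H: "uniform_hypergraph k H" and k: "k \<ge> 1" and z: "adjacency_eigenvector k H l z"
  shows "adjacency_eigenvector k H (complex_of_real l) (\<lambda>i. complex_of_real (z i))"
proof -
  have "edge_form_partial H (\<lambda>i. complex_of_real (z i)) u = of_real (edge_form_partial H z u)" for u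
    by (simp add: edge_form_partial_def)
  moreover have "edge_form_partial H z u = l * z u ^ (k - 1)" if "u \<in> hverts H" for u
    using z that by (simp add: adjacency_eigenvector_iff_partial[OF H k])
  moreover have "\<exists>u\<in>hverts H. z u \<noteq> 0"
    using z by (simp add: adjacency_eigenvector_iff_partial[OF H k])
  ultimately show ?thesis by (simp add: adjacency_eigenvector_iff_partial[OF H k])
qed

text \<open>The bound by absolute values makes the maximum of the edge form an upper bound for all eigenvalue
  moduli, and the maximiser, read as a complex vector, shows that this bound is itself an
  eigenvalue; hence the supremum defining the spectral radius equals it.\<close>

theorem hspectral_radius_variational:
  fixes H :: "'a hypergraph"
  assumes H: "uniform_hypergraph k H" and k: "2 \<le> k" and ne: "hverts H \<noteq> {}"
  shows hspectral_radius_attained: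
      "\<exists>z :: 'a \<Rightarrow> real. (\<forall>i\<in>hverts H. 0 \<le> z i) \<and> (\<Sum>i\<in>hverts H. z i ^ k) = 1
         \<and> real k * edge_form H z = hspectral_radius k H"
    and edge_form_le_hspectral_radius:
      "\<And>y :: 'a \<Rightarrow> real. \<forall>i\<in>hverts H. 0 \<le> y i \<Longrightarrow>
         real k * edge_form H y \<le> hspectral_radius k H * (\<Sum>i\<in>hverts H. y i ^ k)"
proof -
  have k1: "k \<ge> 1" using k by simp
  obtain z :: "'a \<Rightarrow> real"
    where z0: "\<And>i. i \<in> hverts H \<Longrightarrow> 0 \<le> z i" and z1: "(\<Sum>i\<in>hverts H. z i ^ k) = 1"
      and max: "\<And>y :: 'a \<Rightarrow> real. (\<forall>i\<in>hverts H. 0 \<le> y i) \<Longrightarrow>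
           edge_form H y \<le> edge_form H z * (\<Sum>i\<in>hverts H. y i ^ k)"
    using edge_form_attains_max[OF H k1 ne] by blast
  define M where "M = real k * edge_form H z"
  have M0: "0 \<le> M" using edge_form_nonneg[OF H z0] by (simp add: M_def)
  have maxM: "real k * edge_form H y \<le> M * (\<Sum>i\<in>hverts H. y i ^ k)"
    if "\<forall>i\<in>hverts H. 0 \<le> y i" for y :: "'a \<Rightarrow> real"
    using mult_left_mono[OF max[OF that] of_nat_0_le_iff[of k]] by (simp add: M_def mult_ac)
  have nz: "\<exists>i\<in>hverts H. z i \<noteq> 0"
  proof (rule ccontr)
    assume "\<not> ?thesis"
    then have "(\<Sum>i\<in>hverts H. z i ^ k) = 0" using k by simp
    then show False using z1 by simp
  qed
  have "adjacency_eigenvector k H M z"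
    by (rule edge_form_maximiser_eigenvector[OF H k maxM z0 nz]) (simp_all add: z1 M_def)
  then have eig: "adjacency_eigenvector k H (complex_of_real M) (\<lambda>i. complex_of_real (z i))"
    by (rule adjacency_eigenvector_of_real[OF H k1])
  have le: "cmod l \<le> M" if x: "adjacency_eigenvector k H l x" for l and x :: "'a \<Rightarrow> complex"
  proof -
    define s where "s = (\<Sum>u\<in>hverts H. cmod (x u) ^ k)"
    obtain u where u: "u \<in> hverts H" "x u \<noteq> 0"
      using x by (auto simp: adjacency_eigenvector_iff_partial[OF H k1])
    have "0 < s" unfolding s_def
      by (rule sum_pos2[OF _ u(1)]) (use u uniform_hypergraphD(1)[OF H] in auto)
    have "cmod l * s \<le> real k * edge_form H (\<lambda>u. cmod (x u))"
      unfolding s_def by (rule cmod_eigenvalue_le_edge_form[OF H k1 x])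
    also have "\<dots> \<le> M * s" unfolding s_def by (rule maxM) simp
    finally show ?thesis using \<open>0 < s\<close> by simp
  qed
  have \<rho>: "hspectral_radius k H = M"
    unfolding hspectral_radius_def
  proof (rule cSup_eq_maximum)
    have "M = cmod (complex_of_real M)" using M0 by simp
    then show "M \<in> {cmod l | l. \<exists>x :: 'a \<Rightarrow> complex. adjacency_eigenvector k H l x}"
      using eig by blast
  qed (use le in blast)
  show "\<exists>z :: 'a \<Rightarrow> real. (\<forall>i\<in>hverts H. 0 \<le> z i) \<and> (\<Sum>i\<in>hverts H. z i ^ k) = 1
      \<and> real k * edge_form H z = hspectral_radius k H"
    using z0 z1 by (intro exI[of _ z]) (simp add: \<rho> M_def)
  show "real k * edge_form H y \<le> hspectral_radius k H * (\<Sum>i\<in>hverts H. y i ^ k)"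
    if "\<forall>i\<in>hverts H. 0 \<le> y i" for y :: "'a \<Rightarrow> real"
    unfolding \<rho> by (rule maxM[OF that])
qed

section \<open>Deleting a vertex\<close>

lemma uniform_delete_vertex:
  "uniform_hypergraph k H \<Longrightarrow> uniform_hypergraph k (delete_vertex H v)"
  by (auto simp: uniform_hypergraph_def delete_vertex_def)

lemma hspectral_radius_nonneg:
  assumes H: "uniform_hypergraph k H" and k: "2 \<le> k" and ne: "hverts H \<noteq> {}"
  shows "0 \<le> hspectral_radius k H"
proof -
  obtain z :: "'a \<Rightarrow> real"
    where z: "(\<forall>i\<in>hverts H. 0 \<le> z i) \<and> (\<Sum>i\<in>hverts H. z i ^ k) = 1
      \<and> real k * edge_form H z = hspectral_radius k H"
    using hspectral_radius_attained[OF assms] ..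
  then have "0 \<le> edge_form H z" by (intro edge_form_nonneg[OF H]) simp
  then have "0 \<le> real k * edge_form H z" by simp
  then show ?thesis using z by simp
qed

text \<open>A maximiser for the smaller hypergraph, extended by \<open>0\<close>, competes in the larger one.\<close>

lemma hspectral_radius_delete_vertex_le:
  fixes H :: "'a hypergraph"
  assumes H: "uniform_hypergraph k H" and k: "2 \<le> k" and v: "v \<in> hverts H"
    and ne: "hverts H \<noteq> {v}"
  shows "hspectral_radius k (delete_vertex H v) \<le> hspectral_radius k H"
proof -
  let ?D = "delete_vertex H v"
  have vD: "hverts ?D = hverts H - {v}" by (simp add: delete_vertex_def)
  have neD: "hverts ?D \<noteq> {}" unfolding vD using v ne by blast
  obtain z :: "'a \<Rightarrow> real"
    where z: "(\<forall>i\<in>hverts ?D. 0 \<le> z i) \<and> (\<Sum>i\<in>hverts ?D. z i ^ k) = 1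
      \<and> real k * edge_form ?D z = hspectral_radius k ?D"
    using hspectral_radius_attained[OF uniform_delete_vertex[OF H] k neD] ..
  have "(\<Sum>i\<in>hverts H. (z(v := 0)) i ^ k) = (\<Sum>i\<in>hverts ?D. z i ^ k)"
    unfolding vD by (subst sum.remove[OF uniform_hypergraphD(1)[OF H] v]) (use k in auto)
  moreover have "edge_form H (z(v := 0)) = edge_form ?D z"
    by (simp add: edge_form_update[OF H])
  moreover have "real k * edge_form H (z(v := 0))
      \<le> hspectral_radius k H * (\<Sum>i\<in>hverts H. (z(v := 0)) i ^ k)"
  proof -
    have "hverts H \<noteq> {}" using v by blast
    moreover have "\<forall>i\<in>hverts H. 0 \<le> (z(v := 0)) i" using z vD by simp
    ultimately show ?thesis by (rule edge_form_le_hspectral_radius[OF H k])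
  qed
  ultimately show ?thesis using z by simp
qed

text \<open>The edges through \<open>v\<close> carry the weight \<open>l * x v ^ k\<close> by the eigenvalue equation at \<open>v\<close>.\<close>

lemma eigenvector_edge_form_delete_vertex:
  fixes x :: "'a \<Rightarrow> 'b::field_char_0"
  assumes H: "uniform_hypergraph k H" and k: "k \<ge> 1" and x: "adjacency_eigenvector k H l x"
    and v: "v \<in> hverts H"
  shows "of_nat k * edge_form (delete_vertex H v) x
    = l * ((\<Sum>u\<in>hverts H. x u ^ k) - of_nat k * x v ^ k)"
proof -
  have "edge_form_partial H x v = l * x v ^ (k - 1)"
    using x v by (simp add: adjacency_eigenvector_iff_partial[OF H k])
  then have "x v * edge_form_partial H x v = l * x v ^ k"
    using k by (simp add: power_eq_if)
  then show ?thesis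
    using eigenvector_edge_form[OF H k x] edge_form_split[OF H, of x v]
    by (simp add: algebra_simps)
qed

theorem theorem4p4:
  fixes n k v :: nat and G :: "nat hypergraph" and x y :: "nat \<Rightarrow> real"
  assumes "2 \<le> k" and "k \<le> n"
    and "uniform_hypergraph k G" and "hverts G = {1..n}"
    and "adjacency_eigenvector k G (hspectral_radius k G) x"
    and "\<forall>i\<in>hverts G. 0 \<le> x i"
    and "(\<Sum>i\<in>hverts G. \<bar>x i\<bar> ^ k) = 1"
    and "v \<in> hverts G"
    and "y = restrict x ({1..n} - {v})"
  shows "(1 - real k * x v ^ k) * hspectral_radius k G \<le> hspectral_radius k (delete_vertex G v)
    \<and> hspectral_radius k (delete_vertex G v) \<le> hspectral_radius k G
    \<and> (x v ^ k \<noteq> 1 \<longrightarrow>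
         hspectral_radius k (delete_vertex G v)
           \<ge> (1 - real k * x v ^ k) / (1 - x v ^ k) * hspectral_radius k G
       \<and> (connected_hypergraph G \<longrightarrow>
            (hspectral_radius k (delete_vertex G v)
               = (1 - real k * x v ^ k) / (1 - x v ^ k) * hspectral_radius k G
             \<longleftrightarrow> adjacency_eigenvector k (delete_vertex G v)
                   (hspectral_radius k (delete_vertex G v)) y)))"
proof -
  let ?D = "delete_vertex G v"
  let ?r = "hspectral_radius k G" and ?d = "hspectral_radius k (delete_vertex G v)"
  have k1: "k \<ge> 1" using assms(1) by simp
  note G = assms(3)
  have D: "uniform_hypergraph k ?D" by (rule uniform_delete_vertex[OF G])
  have vD: "hverts ?D = hverts G - {v}" by (simp add: delete_vertex_def)
  have card_ge: "card (hverts G) \<ge> 2" using assms(1,2,4) by simp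
  then have neG: "hverts G \<noteq> {v}" by auto
  have neD: "hverts ?D \<noteq> {}" unfolding vD using neG assms(8) by blast
  have yx: "y i = x i" if "i \<in> hverts ?D" for i
    using that assms(4,9) vD by simp
  have y0: "0 \<le> y i" if "i \<in> hverts ?D" for i
    using that yx assms(6) vD by auto
  have sum_x: "(\<Sum>i\<in>hverts G. x i ^ k) = 1" using assms(6,7) by simp
  define p where "p = x v ^ k"
  have p0: "0 \<le> p" using assms(6,8) by (simp add: p_def)
  have sum_y: "(\<Sum>i\<in>hverts ?D. y i ^ k) = 1 - p"
  proof -
    have "(\<Sum>i\<in>hverts ?D. y i ^ k) = (\<Sum>i\<in>hverts G - {v}. x i ^ k)"
      by (rule sum.cong[OF vD]) (simp add: yx vD)
    then show ?thesis
      using sum_x sum.remove[OF uniform_hypergraphD(1)[OF G] assms(8), of "\<lambda>i. x i ^ k"]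
      by (simp add: p_def)
  qed
  have p1: "p \<le> 1" using sum_y sum_nonneg[of "hverts ?D" "\<lambda>i. y i ^ k"] y0 by simp
  have form_y: "real k * edge_form ?D y = (1 - real k * p) * ?r"
    using eigenvector_edge_form_delete_vertex[OF G k1 assms(5,8)] edge_form_cong[OF D yx]
    by (simp add: sum_x p_def mult.commute)
  note max = edge_form_le_hspectral_radius[OF D assms(1) neD]
  have key: "(1 - real k * p) * ?r \<le> (1 - p) * ?d"
    using max[of y] y0 by (simp add: form_y sum_y mult.commute[of _ "1 - p"])
  have d0: "0 \<le> ?d" by (rule hspectral_radius_nonneg[OF D assms(1) neD])
  have lower: "(1 - real k * p) * ?r \<le> ?d"
    using key mult_nonneg_nonneg[OF p0 d0] by (simp add: algebra_simps)
  have upper: "?d \<le> ?r"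
    by (rule hspectral_radius_delete_vertex_le[OF G assms(1,8) neG])
  have quot: "(1 - real k * p) / (1 - p) * ?r \<le> ?d
      \<and> (?d = (1 - real k * p) / (1 - p) * ?r \<longleftrightarrow> adjacency_eigenvector k ?D ?d y)"
    if "p \<noteq> 1"
  proof -
    have pos: "0 < 1 - p" using that p1 by simp
    have eq_iff: "?d = (1 - real k * p) / (1 - p) * ?r
        \<longleftrightarrow> real k * edge_form ?D y = ?d * (\<Sum>i\<in>hverts ?D. y i ^ k)"
      unfolding form_y sum_y using pos by (auto simp: field_simps)
    have nz: "\<exists>i\<in>hverts ?D. y i \<noteq> 0"
    proof (rule ccontr)
      assume "\<not> ?thesis"
      then have "(\<Sum>i\<in>hverts ?D. y i ^ k) = 0" using k1 by simp
      then show False using sum_y pos by simp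
    qed
    have "real k * edge_form ?D y = ?d * (\<Sum>i\<in>hverts ?D. y i ^ k)
        \<longleftrightarrow> adjacency_eigenvector k ?D ?d y"
      using edge_form_maximiser_eigenvector[OF D assms(1) max y0 nz]
        eigenvector_edge_form[OF D k1, of ?d y] by blast
    then show ?thesis
      using eq_iff key pos by (simp add: pos_divide_le_eq mult.commute)
  qed
  show ?thesis using lower upper quot unfolding p_def by blast
qed

end
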